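(* Let $\beta\in(1,2)$. For any sequence $(n_m)_{m \in \mathbb{N}}$ of positive real numbers with $\lim_{m \rightarrow \infty} n_m = \infty$, each $\bm u \in [1,(\beta - 1)^{-1}]^{\mathbb N}$ and each $\varepsilon > 0$ it holds that $$\lim_{m \rightarrow \infty} \lambda\Big( \Big\{ x \in [0,1] : \frac{1}{n_m}\Big|k(m,\bm u,x)- \frac{m \log 2}{\log \beta}\Big| > \varepsilon \Big\}\Big) = 0,$$ i.e., the sequence $\big( \frac1{n_m} \big(k(m,\bm u,x)- \frac{m\log 2}{\log \beta}\big) \big)_{m\ge 1}$ converges to $0$ in $\lambda$-probability.
   Context: $\lambda$ denotes one-dimensional Lebesgue measure, and $\mathbb N=\{1,2,\dots\}$. Bits of the $\beta$-encoder. Given $\beta\in(1,2)$, a threshold sequence $\bm u=(u_n)_{n\ge1}\in[1,(\beta-1)^{-1}]^{\mathbb N}$ and $x\in[0,1]$, put $x_0=x$ and, for $n\ge 1$, let $b_n=0$ if $\beta x_{n-1}<u_n$ and $b_n=1$ if $\beta x_{n-1}\ge u_n$, and $x_n=\beta x_{n-1}-b_n$. For $k\ge1$ define the closed interval $$\mathcal I_k(\bm u,x)=\Big[\sum_{n=1}^k\frac{b_n}{\beta^n},\ \sum_{n=1}^k\frac{b_n}{\beta^n}+\frac{1}{\beta^k(\beta-1)}\Big],$$ where $b_1,\dots,b_k$ are the first $k$ bits produced from $x$ with thresholds $\bm u$. Dyadic intervals. For $m\ge1$ let $\mathcal D_m$ be the partition of $[0,1]$ into the intervals $\big[\frac{j}{2^m},\frac{j+1}{2^m}\big)$,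 $0\le j\le 2^m-1$, where the point $1$ is added to the last interval ($j=2^m-1$). For $x\in[0,1]$, $\mathcal D_m(x)$ denotes the unique element of $\mathcal D_m$ containing $x$. Finally, $$k(m,\bm u,x)=\inf\{k\ge1:\ \mathcal I_k(\bm u,x)\subseteq\mathcal D_m(x)\},$$ with the convention $\inf\emptyset=+\infty$. *)

theory Defs
  imports "HOL-Analysis.Analysis"
begin

text \<open>
  Sequences indexed by \<open>{1, 2, \<dots>}\<close> are functions on \<^typ>\<open>nat\<close> whose value at \<open>0\<close> is
  irrelevant: the threshold \<open>u 0\<close> is never used.
\<close>

definition quantizer :: "real \<Rightarrow> real \<Rightarrow> real" where
  "quantizer t y = (if y < t then 0 else 1)"

primrec encoder_state :: "real \<Rightarrow> (nat \<Rightarrow> real) \<Rightarrow> real \<Rightarrow> nat \<Rightarrow> real" where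
  "encoder_state \<beta> u x 0 = x"
| "encoder_state \<beta> u x (Suc n) =
     \<beta> * encoder_state \<beta> u x n - quantizer (u (Suc n)) (\<beta> * encoder_state \<beta> u x n)"

text \<open>Meaningful for \<open>n \<ge> 1\<close> only; then \<open>x\<^sub>n = \<beta> x\<^sub>n\<^sub>-\<^sub>1 - b\<^sub>n\<close>.\<close>

definition encoder_bit :: "real \<Rightarrow> (nat \<Rightarrow> real) \<Rightarrow> real \<Rightarrow> nat \<Rightarrow> real" where
  "encoder_bit \<beta> u x n = quantizer (u n) (\<beta> * encoder_state \<beta> u x (n - 1))"

definition encoder_interval :: "real \<Rightarrow> (nat \<Rightarrow> real) \<Rightarrow> real \<Rightarrow> nat \<Rightarrow> real set" where
  "encoder_interval \<beta> u x k =
     {(\<Sum>n=1..k. encoder_bit \<beta> u x n / \<beta> ^ n) ..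
      (\<Sum>n=1..k. encoder_bit \<beta> u x n / \<beta> ^ n) + 1 / (\<beta> ^ k * (\<beta> - 1))}"

definition dyadic_interval :: "nat \<Rightarrow> nat \<Rightarrow> real set" where
  "dyadic_interval m j =
     {real j / 2 ^ m ..< (real j + 1) / 2 ^ m} \<union> (if j + 1 = 2 ^ m then {1} else {})"

definition dyadic_partition :: "nat \<Rightarrow> real set set" where
  "dyadic_partition m = dyadic_interval m ` {j. j < 2 ^ m}"

definition dyadic_cell :: "nat \<Rightarrow> real \<Rightarrow> real set" where
  "dyadic_cell m x = (THE D. D \<in> dyadic_partition m \<and> x \<in> D)"

text \<open>On \<^typ>\<open>enat\<close> the infimum of the empty set is \<open>\<infinity>\<close>.\<close>

definition bits_needed :: "real \<Rightarrow> nat \<Rightarrow> (nat \<Rightarrow> real) \<Rightarrow> real \<Rightarrow> enat" where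
  "bits_needed \<beta> m u x =
     Inf {enat k | k. k \<ge> 1 \<and> encoder_interval \<beta> u x k \<subseteq> dyadic_cell m x}"

lemma dyadic_interval_iff:
  assumes "j < 2 ^ m" "x \<in> {0..1}"
  shows "x \<in> dyadic_interval m j \<longleftrightarrow> (if x = 1 then j + 1 = 2 ^ m else nat \<lfloor>x * 2 ^ m\<rfloor> = j)"
proof (cases "x = 1")
  case True
  have "real j + 1 \<le> 2 ^ m"
    using assms(1) by (metis Suc_eq_plus1 Suc_leI of_nat_1 of_nat_add of_nat_le_iff of_nat_numeral of_nat_power)
  then show ?thesis using True by (auto simp: dyadic_interval_def)
next
  case False
  have "x \<in> dyadic_interval m j \<longleftrightarrow> real j \<le> x * 2 ^ m \<and> x * 2 ^ m < real j + 1"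
    using False by (auto simp: dyadic_interval_def field_simps)
  also have "\<dots> \<longleftrightarrow> \<lfloor>x * 2 ^ m\<rfloor> = int j"
    by (simp add: floor_eq_iff)
  also have "\<dots> \<longleftrightarrow> nat \<lfloor>x * 2 ^ m\<rfloor> = j"
    using assms(2) by (auto simp: nat_eq_iff)
  finally show ?thesis using False by simp
qed

lemma dyadic_index_ex1:
  assumes "x \<in> {0..1}"
  shows "\<exists>!j. j < 2 ^ m \<and> x \<in> dyadic_interval m j"
proof (cases "x = 1")
  case True
  have "(2::nat) ^ m - 1 < 2 ^ m \<and> x \<in> dyadic_interval m (2 ^ m - 1)"
    using True by (auto simp: dyadic_interval_def)
  moreover have "j = 2 ^ m - 1" if "j < 2 ^ m \<and> x \<in> dyadic_interval m j" for j
    using that dyadic_interval_iff[of j m x] True by auto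
  ultimately show ?thesis by blast
next
  case False
  have "x * 2 ^ m < 2 ^ m" using False assms by auto
  then have "\<lfloor>x * 2 ^ m\<rfloor> < 2 ^ m" by (simp add: floor_less_iff)
  then have "nat \<lfloor>x * 2 ^ m\<rfloor> < 2 ^ m"
    by (simp add: nat_less_iff assms)
  then show ?thesis
    using dyadic_interval_iff[OF _ assms] False by (metis (no_types, lifting))
qed

lemma dyadic_cell_eq:
  assumes "x \<in> {0..1}" "j < 2 ^ m" "x \<in> dyadic_interval m j"
  shows "dyadic_cell m x = dyadic_interval m j"
  unfolding dyadic_cell_def dyadic_partition_def
  using dyadic_index_ex1[OF assms(1), of m] assms(2,3) by (intro the_equality) auto

lemma dyadic_partition_ex1:
  assumes "x \<in> {0..1}"
  shows "\<exists>!D. D \<in> dyadic_partition m \<and> x \<in> D"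
  unfolding dyadic_partition_def using dyadic_index_ex1[OF assms, of m] by auto

lemma measurable_encoder_bit [measurable]:
  "(\<lambda>x. encoder_bit \<beta> u x n) \<in> borel_measurable borel"
proof -
  have [measurable]: "(\<lambda>x. encoder_state \<beta> u x k) \<in> borel_measurable borel" for k
    by (induction k) (simp_all add: quantizer_def)
  show ?thesis unfolding encoder_bit_def quantizer_def by measurable
qed

lemma Icc_subset_dyadic_interval_iff:
  assumes "a \<le> b" "j < 2 ^ m"
  shows "{a..b} \<subseteq> dyadic_interval m j \<longleftrightarrow> a \<in> dyadic_interval m j \<and> b \<in> dyadic_interval m j"
proof -
  have "dyadic_interval m j =
    (if j + 1 = 2 ^ m then {real j / 2 ^ m .. 1} else {real j / 2 ^ m ..< (real j + 1) / 2 ^ m})"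
  proof (cases "j + 1 = 2 ^ m")
    case True
    then have "real j + 1 = 2 ^ m"
      by (metis of_nat_1 of_nat_add of_nat_numeral of_nat_power)
    moreover have "real j \<le> 2 ^ m" using calculation by linarith
    then have "real j / 2 ^ m \<le> 1" by simp
    ultimately show ?thesis using True by (auto simp: dyadic_interval_def)
  qed (auto simp: dyadic_interval_def)
  then obtain l h where "dyadic_interval m j = {l..h} \<or> dyadic_interval m j = {l..<h}"
    by metis
  then show ?thesis
  proof
    assume "dyadic_interval m j = {l..h}"
    then show ?thesis using assms(1) by (simp only: atLeastatMost_subset_iff atLeastAtMost_iff) (meson order_trans)
  next
    assume "dyadic_interval m j = {l..<h}"
    then show ?thesis using assms(1)
      by (simp only: atLeastAtMost_subseteq_atLeastLessThan_iff atLeastLessThan_iff) (meson order_trans order_le_less_trans)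
  qed
qed

text \<open>
  \<^const>\<open>measure\<close> is \<open>0\<close> outside the measurable sets; the next lemma rules this case out for
  every event that is described by \<^const>\<open>bits_needed\<close>.
\<close>

lemma bits_needed_measurable:
  assumes "\<beta> > 1"
  shows "{x \<in> {0..1}. P (bits_needed \<beta> m u x)} \<in> sets lborel"
proof -
  define A where "A k = {x \<in> {0..1}. encoder_interval \<beta> u x k \<subseteq> dyadic_cell m x}" for k
  define s where "s k x = (\<Sum>n=1..k. encoder_bit \<beta> u x n / \<beta> ^ n)" for k x
  define r where "r k = 1 / (\<beta> ^ k * (\<beta> - 1))" for k
  have r: "r k \<ge> 0" for k using assms by (auto simp: r_def)
  have [measurable]: "s k \<in> borel_measurable borel" for k unfolding s_def by measurable
  have [measurable]: "dyadic_interval m j \<in> sets borel" for j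
    unfolding dyadic_interval_def by auto
  have I: "encoder_interval \<beta> u x k = {s k x .. s k x + r k}" for x k
    by (simp add: encoder_interval_def s_def r_def)
  have A_eq: "A k = (\<Union>j\<in>{j. j < 2 ^ m}. {x \<in> {0..1}. x \<in> dyadic_interval m j \<and>
      s k x \<in> dyadic_interval m j \<and> s k x + r k \<in> dyadic_interval m j})" for k
  proof (intro set_eqI)
    fix x
    show "x \<in> A k \<longleftrightarrow> x \<in> (\<Union>j\<in>{j. j < 2 ^ m}. {x \<in> {0..1}. x \<in> dyadic_interval m j \<and>
      s k x \<in> dyadic_interval m j \<and> s k x + r k \<in> dyadic_interval m j})"
    proof (cases "x \<in> {0..1}")
      case True
      obtain j where j: "j < 2 ^ m" "x \<in> dyadic_interval m j"
        using dyadic_index_ex1[OF True, of m] by blast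
      have "x \<in> A k \<longleftrightarrow> s k x \<in> dyadic_interval m j \<and> s k x + r k \<in> dyadic_interval m j"
        using True dyadic_cell_eq[OF True j] Icc_subset_dyadic_interval_iff[OF _ j(1), of "s k x" "s k x + r k"] r[of k]
        by (simp add: A_def I)
      moreover have "i = j" if "i < 2 ^ m" "x \<in> dyadic_interval m i" for i
        using that j dyadic_index_ex1[OF True, of m] by blast
      ultimately show ?thesis using True j by blast
    qed (auto simp: A_def)
  qed
  have A [measurable]: "A k \<in> sets borel" for k
    unfolding A_eq by measurable
  define B where "B e = (case e of enat k \<Rightarrow> if k = 0 then {} else A k - (\<Union>i\<in>{1..<k}. A i)
      | \<infinity> \<Rightarrow> {0..1} - (\<Union>i\<in>{1..}. A i))" for e
  have B [measurable]: "B e \<in> sets borel" for e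
    unfolding B_def by (cases e) auto
  have "x \<in> B (bits_needed \<beta> m u x)" if x: "x \<in> {0..1}" for x
  proof -
    let ?S = "{enat k | k. k \<ge> 1 \<and> x \<in> A k}"
    have eq: "bits_needed \<beta> m u x = Inf ?S"
      using x by (simp add: bits_needed_def A_def)
    show ?thesis
    proof (cases "?S = {}")
      case True
      then have "bits_needed \<beta> m u x = \<infinity>" by (simp only: eq Inf_empty top_enat_def)
      then show ?thesis using True x by (auto simp: B_def)
    next
      case False
      then have "Inf ?S \<in> ?S" by (metis (no_types, lifting) wellorder_InfI ex_in_conv)
      then obtain k where k: "Inf ?S = enat k" "k \<ge> 1" "x \<in> A k" by blast
      have "x \<notin> A i" if "i \<in> {1..<k}" for i
      proof
        assume "x \<in> A i"
        then have "Inf ?S \<le> enat i" using that by (intro Inf_lower) auto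
        then show False using k(1) that by simp
      qed
      then show ?thesis using k unfolding eq k(1) by (auto simp: B_def)
    qed
  qed
  moreover have "e = f" if "x \<in> B e" "x \<in> B f" for x e f
  proof -
    have fin: "k \<ge> 1 \<and> x \<in> A k \<and> (\<forall>i. 1 \<le> i \<and> i < k \<longrightarrow> x \<notin> A i)" if "x \<in> B (enat k)" for k
      using that by (auto simp: B_def split: if_splits)
    have inf: "\<forall>i\<ge>1. x \<notin> A i" if "x \<in> B \<infinity>"
      using that by (auto simp: B_def)
    show ?thesis
    proof (cases e; cases f)
      fix k l assume "e = enat k" "f = enat l"
      then show ?thesis using that fin[of k] fin[of l] by (cases k l rule: linorder_cases) auto
    qed (use that fin inf in auto)
  qed
  moreover have "B e \<subseteq> {0..1}" for e
    by (cases e) (auto simp: B_def A_def split: if_splits)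
  ultimately have "{x \<in> {0..1}. P (bits_needed \<beta> m u x)} = (\<Union>e\<in>{e. P e}. B e)"
    by blast
  also have "\<dots> \<in> sets borel" by (intro sets.countable_UN'') auto
  finally show ?thesis by simp
qed

end

theory Submission
  imports Defs
begin

text \<open>
  The interval \<open>I\<^sub>k\<close> contains \<open>x\<close> and has length \<open>L\<^sub>k = 1 / (\<beta>\<^sup>k (\<beta> - 1))\<close>.  If it lies in a dyadic
  cell then \<open>L\<^sub>k \<le> 2\<^sup>-\<^sup>m\<close>, and since \<open>\<beta> - 1 < 1\<close> this forces \<open>k \<ge> m ln 2 / ln \<beta>\<close>: the lower tail is
  empty.  For the upper tail, \<open>I\<^sub>k\<close> can only fail to lie in the cell of \<open>x\<close> if \<open>x\<close> is within \<open>L\<^sub>k\<close> of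
  one of the \<open>2\<^sup>m + 1\<close> dyadic points, which has probability \<open>O(2\<^sup>m / \<beta>\<^sup>k)\<close>; at
  \<open>k \<approx> m ln 2 / ln \<beta> + \<epsilon> n\<^sub>m\<close> this is \<open>O(\<beta> powr (-\<epsilon> n\<^sub>m))\<close>.
\<close>

text \<open>The upper bound is weak so that it also covers the last cell, which contains its right
  endpoint 1.\<close>

lemma dyadic_interval_bounds:
  assumes "y \<in> dyadic_interval m j"
  shows "real j / 2 ^ m \<le> y" "y \<le> (real j + 1) / 2 ^ m"
proof -
  have "real j + 1 = 2 ^ m" if "j + 1 = 2 ^ m"
    using that by (metis of_nat_1 of_nat_add of_nat_numeral of_nat_power)
  then show "real j / 2 ^ m \<le> y" "y \<le> (real j + 1) / 2 ^ m"
    using assms by (auto simp: dyadic_interval_def field_simps split: if_splits)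
qed

lemma dyadic_cell_obtain:
  assumes "x \<in> {0..1}"
  obtains j where "j < 2 ^ m" "x \<in> dyadic_interval m j" "dyadic_cell m x = dyadic_interval m j"
  using dyadic_index_ex1[OF assms, of m] dyadic_cell_eq[OF assms] by blast

lemma Icc_subset_dyadic_cell_imp_length_le:
  assumes "x \<in> {0..1}" "a \<le> b" "{a..b} \<subseteq> dyadic_cell m x"
  shows "b - a \<le> 1 / 2 ^ m"
proof -
  obtain j where j: "dyadic_cell m x = dyadic_interval m j"
    using dyadic_cell_obtain[OF assms(1)] by blast
  have "a \<in> dyadic_interval m j" "b \<in> dyadic_interval m j"
    using assms j by auto
  then have "real j / 2 ^ m \<le> a" "b \<le> (real j + 1) / 2 ^ m"
    using dyadic_interval_bounds by blast+
  then show ?thesis by (simp add: add_divide_distrib)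
qed

text \<open>Both endpoints of the cell of \<open>x\<close> are dyadic points, so an interval of
  length \<open>L\<close> through \<open>x\<close> reaches neither. The index runs up to
  \<open>2 ^ m\<close> inclusive so that the right endpoint of the last cell is among them.\<close>

lemma Icc_subset_dyadic_cell:
  assumes x: "x \<in> {0..1}" "x \<in> {a..a + L}"
    and far: "\<And>j. j \<le> 2 ^ m \<Longrightarrow> L < \<bar>x - real j / 2 ^ m\<bar>"
  shows "{a..a + L} \<subseteq> dyadic_cell m x"
proof -
  obtain j where j: "j < 2 ^ m" "x \<in> dyadic_interval m j" "dyadic_cell m x = dyadic_interval m j"
    using dyadic_cell_obtain[OF x(1)] by blast
  have "L < x - real j / 2 ^ m"
    using far[of j] j dyadic_interval_bounds[OF j(2)] by simp
  moreover have "L < (real j + 1) / 2 ^ m - x"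
    using far[of "Suc j"] j(1) dyadic_interval_bounds[OF j(2)] by (simp add: add.commute)
  ultimately have "{a..a + L} \<subseteq> {real j / 2 ^ m ..< (real j + 1) / 2 ^ m}"
    using x(2) by auto
  then show ?thesis unfolding j(3) dyadic_interval_def by blast
qed

lemma measure_near_dyadic_le:
  assumes "L \<ge> 0" "S \<subseteq> (\<Union>j\<in>{..2 ^ m}. {real j / 2 ^ m - L .. real j / 2 ^ m + L})"
  shows "measure lborel S \<le> 4 * 2 ^ m * L"
proof -
  let ?U = "\<Union>j\<in>{..2 ^ m}. {real j / 2 ^ m - L .. real j / 2 ^ m + L}"
  have fm: "?U \<in> fmeasurable lborel"
    by (intro fmeasurable.finite_UN fmeasurableI) (auto simp: emeasure_lborel_Icc_eq)
  have "measure lborel S \<le> measure lborel ?U"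
  \<comment> \<open>A non-measurable \<open>S\<close> has \<open>measure\<close> 0 by convention, so
    the bound holds for any \<open>S\<close>.\<close>
  proof (cases "S \<in> sets lborel")
    case True
    then show ?thesis using assms(2) fm by (intro measure_mono_fmeasurable) auto
  qed (simp add: measure_notin_sets)
  also have "\<dots> \<le> (\<Sum>j\<in>{..2 ^ m}. measure lborel {real j / 2 ^ m - L .. real j / 2 ^ m + L})"
    by (rule measure_UNION_le) auto
  also have "\<dots> = (2 ^ m + 1) * (2 * L)"
    using assms(1) by simp
  \<comment> \<open>There are \<open>2 ^ m + 1\<close> dyadic points; the extra one is absorbed by
    doubling.\<close>
  also have "\<dots> \<le> (2 * 2 ^ m) * (2 * L)"
    using assms(1) by (intro mult_right_mono) auto
  finally show ?thesis by simp
qed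

context
  fixes \<beta> :: real and u :: "nat \<Rightarrow> real"
  assumes \<beta>: "1 < \<beta>" "\<beta> < 2"
    and u: "\<And>i. i \<ge> 1 \<Longrightarrow> u i \<in> {1 .. 1 / (\<beta> - 1)}"
begin

text \<open>The interval is invariant:
  \<open>\<beta> / (\<beta> - 1) = 1 / (\<beta> - 1) + 1\<close>, a bit 1 is subtracted only above a
  threshold that is at least 1, and a bit 0 occurs only below a threshold that is at most
  \<open>1 / (\<beta> - 1)\<close>. It contains the starting point since
  \<open>\<beta> < 2\<close>.\<close>

lemma encoder_state_bounds:
  assumes "x \<in> {0..1}"
  shows "encoder_state \<beta> u x k \<in> {0 .. 1 / (\<beta> - 1)}"
proof (induction k)
  case 0
  have "1 \<le> 1 / (\<beta> - 1)" using \<beta> by simp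
  then show ?case using assms by (simp del: le_divide_eq_1)
next
  case (Suc k)
  let ?y = "encoder_state \<beta> u x k"
  have "\<beta> * ?y \<le> \<beta> * (1 / (\<beta> - 1))"
    using Suc \<beta> by (intro mult_left_mono) auto
  also have "\<dots> = 1 / (\<beta> - 1) + 1"
    using \<beta> by (simp add: field_simps)
  finally have "\<beta> * ?y \<le> 1 / (\<beta> - 1) + 1" .
  moreover have "0 \<le> \<beta> * ?y" using Suc \<beta> by simp
  ultimately show ?case
    using u[of "Suc k"] by (auto simp: quantizer_def)
qed

text \<open>Iterates \<open>x\<^sub>k = (b\<^sub>k\<^sub>+\<^sub>1 + x\<^sub>k\<^sub>+\<^sub>1) /
  \<beta>\<close>; the remainder is the scaled state.\<close>

lemma encoder_expansion:
  "x = (\<Sum>n=1..k. encoder_bit \<beta> u x n / \<beta> ^ n) + encoder_state \<beta> u x k / \<beta> ^ k"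
proof (induction k)
  case (Suc k)
  have "encoder_state \<beta> u x k / \<beta> ^ k =
      encoder_bit \<beta> u x (Suc k) / \<beta> ^ Suc k + encoder_state \<beta> u x (Suc k) / \<beta> ^ Suc k"
    using \<beta> by (simp add: encoder_bit_def field_simps)
  then show ?case using Suc by simp
qed simp

lemma mem_encoder_interval:
  assumes "x \<in> {0..1}"
  shows "x \<in> encoder_interval \<beta> u x k"
proof -
  let ?y = "encoder_state \<beta> u x k"
  have "0 \<le> ?y / \<beta> ^ k" "?y / \<beta> ^ k \<le> 1 / (\<beta> - 1) / \<beta> ^ k"
    using divide_right_mono[of ?y "1 / (\<beta> - 1)" "\<beta> ^ k"] encoder_state_bounds[OF assms, of k] \<beta>
    by auto
  then show ?thesis
    using encoder_expansion[of x k] unfolding encoder_interval_def by (simp add: mult.commute)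
qed

lemma encoder_interval_subset_imp_ge:
  assumes "x \<in> {0..1}" "encoder_interval \<beta> u x k \<subseteq> dyadic_cell m x"
  shows "real m * ln 2 / ln \<beta> \<le> real k"
proof -
  have "1 / (\<beta> ^ k * (\<beta> - 1)) \<le> 1 / 2 ^ m"
    using Icc_subset_dyadic_cell_imp_length_le[OF assms(1) _ assms(2)[unfolded encoder_interval_def]] \<beta>
    by simp
  then have "2 ^ m \<le> \<beta> ^ k * (\<beta> - 1)"
    using \<beta> by (simp add: field_simps)
  also have "\<dots> \<le> \<beta> ^ k"
    using \<beta> by (simp add: mult_left_le)
  finally have "ln (2 ^ m) \<le> ln (\<beta> ^ k)"
    using \<beta> by simp
  then show ?thesis
    using \<beta> by (simp add: ln_realpow field_simps)
qed

lemma bits_needed_ge: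
  assumes "x \<in> {0..1}"
  shows "ereal (real m * ln 2 / ln \<beta>) \<le> ereal_of_enat (bits_needed \<beta> m u x)"
proof (cases "bits_needed \<beta> m u x")
  case (enat k)
  let ?S = "{enat k | k. k \<ge> 1 \<and> encoder_interval \<beta> u x k \<subseteq> dyadic_cell m x}"
  have "?S \<noteq> {}"
  proof
    assume "?S = {}"
    then have "bits_needed \<beta> m u x = \<infinity>"
      unfolding bits_needed_def by (simp only: Inf_empty top_enat_def)
    then show False using enat by simp
  qed
  \<comment> \<open>\<open>enat\<close> is well-ordered, so the infimum of a nonempty set is
    attained and the bound for a single \<open>k\<close> applies to it.\<close>
  then have "Inf ?S \<in> ?S" by (metis (no_types, lifting) wellorder_InfI ex_in_conv)
  then have "encoder_interval \<beta> u x k \<subseteq> dyadic_cell m x"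
    using enat unfolding bits_needed_def by auto
  then show ?thesis
    using encoder_interval_subset_imp_ge[OF assms] enat by simp
qed simp

lemma bits_needed_le_or_near_dyadic:
  assumes "x \<in> {0..1}" "k \<ge> 1"
  defines "L \<equiv> 1 / (\<beta> ^ k * (\<beta> - 1))"
  shows "bits_needed \<beta> m u x \<le> enat k \<or>
    x \<in> (\<Union>j\<in>{..2 ^ m}. {real j / 2 ^ m - L .. real j / 2 ^ m + L})"
proof (rule disjCI)
  assume "x \<notin> (\<Union>j\<in>{..2 ^ m}. {real j / 2 ^ m - L .. real j / 2 ^ m + L})"
  then have "L < \<bar>x - real j / 2 ^ m\<bar>" if "j \<le> 2 ^ m" for j
    using that by (force simp: abs_less_iff not_le)
  then have "encoder_interval \<beta> u x k \<subseteq> dyadic_cell m x"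
    using Icc_subset_dyadic_cell[OF assms(1)] mem_encoder_interval[OF assms(1), of k]
    unfolding encoder_interval_def L_def by blast
  then show "bits_needed \<beta> m u x \<le> enat k"
    unfolding bits_needed_def using assms(2) by (intro Inf_lower) blast
qed

lemma measure_deviation_le:
  assumes "m \<ge> 1" "N > 0" "\<epsilon> > 0"
  shows "measure lborel {x \<in> {0..1}. ereal (1 / N) *
      \<bar>ereal_of_enat (bits_needed \<beta> m u x) - ereal (real m * ln 2 / ln \<beta>)\<bar> > ereal \<epsilon>}
    \<le> 4 * \<beta> / (\<beta> - 1) * exp (- (\<epsilon> * ln \<beta> * N))"
    (is "measure lborel ?S \<le> _")
proof -
  define M where "M = real m * ln 2 / ln \<beta>"
  \<comment> \<open>The largest bit count that is not an upper deviation. Rounding down loses less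
    than one bit, which costs a factor \<open>\<beta>\<close> in the final bound.\<close>
  define k where "k = nat \<lfloor>M + \<epsilon> * N\<rfloor>"
  define L where "L = 1 / (\<beta> ^ k * (\<beta> - 1))"
  have ln: "ln \<beta> > 0" "ln \<beta> \<le> ln 2" using \<beta> by auto
  have "1 * ln \<beta> \<le> real m * ln 2" using assms(1) ln by (intro mult_mono) auto
  then have "M \<ge> 1" using ln by (simp add: M_def)
  moreover have "\<epsilon> * N > 0" using assms by simp
  ultimately have k: "k \<ge> 1" "real k \<le> M + \<epsilon> * N" "M + \<epsilon> * N < real k + 1"
    unfolding k_def by linarith+
  have "?S \<subseteq> (\<Union>j\<in>{..2 ^ m}. {real j / 2 ^ m - L .. real j / 2 ^ m + L})"
  proof
    fix x assume "x \<in> ?S"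
    then have x: "x \<in> {0..1}"
      and dev: "ereal \<epsilon> < ereal (1 / N) * \<bar>ereal_of_enat (bits_needed \<beta> m u x) - ereal M\<bar>"
      unfolding M_def by auto
    \<comment> \<open>The lower bound \<open>M\<close> on the bit count makes the deviation
      one-sided, so it must exceed \<open>\<epsilon> * N\<close> upwards. An infinite bit count is
      covered as well.\<close>
    have "\<not> bits_needed \<beta> m u x \<le> enat k"
    proof
      assume le: "bits_needed \<beta> m u x \<le> enat k"
      then obtain l where l: "bits_needed \<beta> m u x = enat l" "l \<le> k"
        by (cases "bits_needed \<beta> m u x") auto
      have "M \<le> real l"
        using bits_needed_ge[OF x, of m] l unfolding M_def by simp
      then have "\<epsilon> < 1 / N * (real l - M)"
        using dev l by simp
      then have "\<epsilon> * N < real l - M"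
        using assms(2) by (simp add: field_simps)
      then show False using k l(2) by linarith
    qed
    then show "x \<in> (\<Union>j\<in>{..2 ^ m}. {real j / 2 ^ m - L .. real j / 2 ^ m + L})"
      using bits_needed_le_or_near_dyadic[OF x k(1)] unfolding L_def by blast
  qed
  then have "measure lborel ?S \<le> 4 * 2 ^ m * L"
    using \<beta> by (intro measure_near_dyadic_le) (auto simp: L_def)
  also have "\<dots> \<le> 4 * \<beta> / (\<beta> - 1) * exp (- (\<epsilon> * ln \<beta> * N))"
  proof -
    have "real m * ln 2 + \<epsilon> * ln \<beta> * N = (M + \<epsilon> * N) * ln \<beta>"
      using ln by (simp add: M_def algebra_simps)
    also have "\<dots> \<le> (real k + 1) * ln \<beta>"
      using k ln by (intro mult_right_mono) auto
    finally have "exp (real m * ln 2 + \<epsilon> * ln \<beta> * N) \<le> exp (real (Suc k) * ln \<beta>)"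
      by (simp add: add.commute)
    then have "2 ^ m * exp (\<epsilon> * ln \<beta> * N) \<le> \<beta> ^ Suc k"
      using \<beta> by (simp only: exp_add exp_of_nat_mult) simp
    then have "2 ^ m / \<beta> ^ k \<le> \<beta> * exp (- (\<epsilon> * ln \<beta> * N))"
      using \<beta> by (simp add: exp_minus field_simps)
    then have "4 / (\<beta> - 1) * (2 ^ m / \<beta> ^ k) \<le> 4 / (\<beta> - 1) * (\<beta> * exp (- (\<epsilon> * ln \<beta> * N)))"
      using \<beta> by (intro mult_left_mono) auto
    then show ?thesis
      by (simp add: L_def mult_ac)
  qed
  finally show ?thesis .
qed

end

theorem corollary1p1:
  fixes \<beta> \<epsilon> :: real and n u :: "nat \<Rightarrow> real"
  assumes "1 < \<beta>" and "\<beta> < 2"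
    and "\<And>m. m \<ge> 1 \<Longrightarrow> n m > 0"
    and "filterlim n at_top sequentially"
    and "\<And>i. i \<ge> 1 \<Longrightarrow> u i \<in> {1 .. 1 / (\<beta> - 1)}"
    and "\<epsilon> > 0"
  shows "(\<lambda>m. measure lborel {x \<in> {0..1}.
            ereal (1 / n m) *
              \<bar>ereal_of_enat (bits_needed \<beta> m u x) - ereal (real m * ln 2 / ln \<beta>)\<bar>
            > ereal \<epsilon>}) \<longlonglongrightarrow> 0"
proof (rule Lim_null_comparison)
  have "filterlim (\<lambda>m. \<epsilon> * ln \<beta> * n m) at_top sequentially"
    using assms by (intro filterlim_tendsto_pos_mult_at_top[OF tendsto_const]) auto
  then have "(\<lambda>m. exp (- (\<epsilon> * ln \<beta> * n m))) \<longlonglongrightarrow> 0"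
    by (intro filterlim_compose[OF exp_at_bot]) (simp add: filterlim_uminus_at_bot)
  then show "(\<lambda>m. 4 * \<beta> / (\<beta> - 1) * exp (- (\<epsilon> * ln \<beta> * n m))) \<longlonglongrightarrow> 0"
    by (rule tendsto_mult_right_zero)
next
  show "\<forall>\<^sub>F m in sequentially. norm (measure lborel {x \<in> {0..1}.
            ereal (1 / n m) *
              \<bar>ereal_of_enat (bits_needed \<beta> m u x) - ereal (real m * ln 2 / ln \<beta>)\<bar>
            > ereal \<epsilon>}) \<le> 4 * \<beta> / (\<beta> - 1) * exp (- (\<epsilon> * ln \<beta> * n m))"
    unfolding real_norm_def abs_of_nonneg[OF measure_nonneg]
    \<comment> \<open>From \<open>m = 1\<close> on, \<open>n m\<close> is positive and the bound
      applies.\<close>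
    by (rule eventually_sequentiallyI[of 1]) (rule measure_deviation_le[OF assms(1,2,5) _ assms(3,6)])
qed

end
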